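(* Let $\Sigma$ be the set of sufficient statistics, $\tilde\Sigma\subseteq\Sigma$ the sampled set, and let $t\in\{0,1,\dots,T\}$ be the number of backup steps (horizon). The error from using point-based value iteration instead of full value iteration satisfies $$\epsilon(t)=\big\|V_{T-t}^{\tilde\Sigma}-V_{T-t}^*\big\|_\infty\le t\,\delta(\tilde\Sigma).$$
   Context: Hybrid system. The state is $s=(x,q)\in\mathcal{S}=\mathcal{X}\times\mathcal{Q}$ with $\mathcal{X}\subseteq\mathbb{R}^n$ and $\mathcal{Q}$ a finite set of modes (functions on $\mathcal{X}$ are extended by zero to $\mathbb{R}^n$). The control set $\mathcal{U}$ is finite. The transition kernel has the form $\tau(x',q'\mid x,q,u)=T_x(x'\mid x,u,q')\,T_q(q'\mid x,q,u)$, where $T_q(\cdot\mid x,q,u)$ is a probability distribution on $\mathcal{Q}$ and $T_x(\cdot\mid x,u,q')$ is a probability density on $\mathbb{R}^n$, both measurable in their arguments. $K\subseteq\mathcal{X}\times\mathcal{Q}$ is a Borel set (the safe set), $\mathbf{1}_K$ its indicator function, and $T\in\mathbb{N}$ the time horizon. Observations $y=(y^x,y^q)$: $y^q$ takes values in a finite set of $N_{y^q}$ elements and $Q_{q,y^q}(u)$ is the probability of observing $y^q$ when the mode is $q$ and the preceding control was $u$; $y^x$ takes values in a finite set of $N_{y^x}$ elements and $\varphi(y^x\mid x,u)$ is the probability of observing $y^x$ when the continuous state is $x$ and the preceding control was $u$. Notation: $\langle f,g\rangle=\sum_{q\in\mathcal{Q}}\int_{\mathbb{R}^n} f(x,q)g(x,q)\,dx$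 and $\|f\|_1=\sum_q\int|f(x,q)|\,dx$. The update operator is $$\Phi_{y,u}[\sigma](x',q')=N_{y^q}N_{y^x}\,Q_{q',y^q}(u)\,\varphi(y^x\mid x',u)\sum_{q\in\mathcal{Q}}\int_{\mathbb{R}^n}\mathbf{1}_K(x,q)\,\tau(x',q'\mid x,q,u)\,\sigma(x,q)\,dx .$$ $\Sigma$ is the set of all possible sufficient statistics, i.e. all functions obtained from some initial probability density $\rho$ on $\mathcal{S}$ by applying finitely many (possibly zero) operators $\Phi_{y,u}$. $\tilde\Sigma\subseteq\Sigma$ is a nonempty finite subset (sampled points). For functions $V$ on $\Sigma$, $\|V\|_\infty=\sup_{\sigma\in\Sigma}|V(\sigma)|$. The density of the sample is measured by $$\delta(\tilde\Sigma)=\sup_{\sigma\in\Sigma}\inf_{\tilde\sigma\in\tilde\Sigma}\|\tilde\sigma-\sigma\|_1 .$$ Full value iteration: $V_T^*(\sigma)=\langle\sigma,\mathbf{1}_K\rangle$ and $V_t^*=H[V_{t+1}^*]$, where $$H[V](\sigma)=\sup_{u\in\mathcal{U}}\frac{1}{N_{y^q}N_{y^x}}\sum_y V(\Phi_{y,u}[\sigma]).$$ Point-based value iteration: $\tilde\Gamma_T=\{\mathbf{1}_K\}$. Given a finite set $\tilde\Gamma_{t+1}=\{\alpha_{t+1}^i\}$, put $$\alpha_{y,u}^i(x,q)=\mathbf{1}_K(x,q)\sum_{q'}\int_{\mathbb{R}^n}\alpha_{t+1}^i(x',q')\,Q_{q',y^q}(u)\,\varphi(y^x\mid x',u)\,\tau(x',q'\mid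 x,q,u)\,dx',$$ let $\alpha_{y,u,\sigma}$ be a function $\alpha_{y,u}^i$ whose index $i$ maximizes $\langle\alpha_{y,u}^i,\sigma\rangle$, and set $\tilde\Gamma_t=\bigcup_{\sigma\in\tilde\Sigma}\{\sum_y\alpha_{y,u,\sigma}: u\in\mathcal{U}\}$. The approximate value function is $V_t^{\tilde\Sigma}(\sigma)=\max_{\alpha\in\tilde\Gamma_t}\langle\alpha,\sigma\rangle$, and $\tilde H$ denotes the point-based backup, $V_t^{\tilde\Sigma}=\tilde H[V_{t+1}^{\tilde\Sigma}]$. *)

theory Defs
  imports "HOL-Analysis.Analysis"
begin

text \<open>
  Modes, controls and the two observation alphabets are finite types. A state is a pair
  \<open>(x, q)\<close>. Arguments are in the order of the conditional notation:
  \<open>Tx M x' x u q'\<close> is $T_x(x' \mid x,u,q')$, \<open>Tq M q' x q u\<close> is $T_q(q' \mid x,q,u)$,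
  \<open>Qobs M q yq u\<close> is $Q_{q,y^q}(u)$ and \<open>phi M yx x u\<close> is $\varphi(y^x \mid x,u)$.
\<close>

record ('n, 'q, 'u, 'yx, 'yq) hybrid =
  Xset :: "(real ^ 'n) set"
  safe :: "((real ^ 'n) \<times> 'q) set"
  Tx   :: "real ^ 'n \<Rightarrow> real ^ 'n \<Rightarrow> 'u \<Rightarrow> 'q \<Rightarrow> real"
  Tq   :: "'q \<Rightarrow> real ^ 'n \<Rightarrow> 'q \<Rightarrow> 'u \<Rightarrow> real"
  Qobs :: "'q \<Rightarrow> 'yq \<Rightarrow> 'u \<Rightarrow> real"
  phi  :: "'yx \<Rightarrow> real ^ 'n \<Rightarrow> 'u \<Rightarrow> real"

type_synonym ('n, 'q) sfun = "(real ^ 'n) \<times> 'q \<Rightarrow> real"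

text \<open>
  Functions of the continuous state are extended by zero from \<open>Xset M\<close> to the whole space. The
  density \<open>\<lambda>x'. Tx M x' x u q'\<close> lives on the whole space and need not vanish outside \<open>Xset M\<close>.
\<close>

definition hybrid_system ::
  "('n::finite, 'q::finite, 'u::finite, 'yx::finite, 'yq::finite) hybrid \<Rightarrow> bool" where
  "hybrid_system M \<longleftrightarrow>
     Xset M \<in> sets borel \<and>
     safe M \<in> sets (borel \<Otimes>\<^sub>M count_space UNIV) \<and> safe M \<subseteq> Xset M \<times> UNIV \<and>
     (\<forall>u q'. (\<lambda>(x', x). Tx M x' x u q') \<in> borel_measurable (borel \<Otimes>\<^sub>M borel)) \<and>
     (\<forall>x\<in>Xset M. \<forall>u q'. (\<forall>x'. 0 \<le> Tx M x' x u q') \<and>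
        has_bochner_integral lborel (\<lambda>x'. Tx M x' x u q') 1) \<and>
     (\<forall>x. x \<notin> Xset M \<longrightarrow> (\<forall>x' u q'. Tx M x' x u q' = 0)) \<and>
     (\<forall>q' q u. (\<lambda>x. Tq M q' x q u) \<in> borel_measurable borel) \<and>
     (\<forall>x\<in>Xset M. \<forall>q u. (\<forall>q'. 0 \<le> Tq M q' x q u) \<and> (\<Sum>q'\<in>UNIV. Tq M q' x q u) = 1) \<and>
     (\<forall>x. x \<notin> Xset M \<longrightarrow> (\<forall>q' q u. Tq M q' x q u = 0)) \<and>
     (\<forall>q u. (\<forall>yq. 0 \<le> Qobs M q yq u) \<and> (\<Sum>yq\<in>UNIV. Qobs M q yq u) = 1) \<and>
     (\<forall>yx u. (\<lambda>x. phi M yx x u) \<in> borel_measurable borel) \<and>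
     (\<forall>x\<in>Xset M. \<forall>u. (\<forall>yx. 0 \<le> phi M yx x u) \<and> (\<Sum>yx\<in>UNIV. phi M yx x u) = 1) \<and>
     (\<forall>x. x \<notin> Xset M \<longrightarrow> (\<forall>yx u. phi M yx x u = 0))"

definition tau ::
  "('n::finite, 'q, 'u, 'yx, 'yq) hybrid \<Rightarrow> real ^ 'n \<Rightarrow> 'q \<Rightarrow> real ^ 'n \<Rightarrow> 'q \<Rightarrow> 'u \<Rightarrow> real" where
  "tau M x' q' x q u = Tx M x' x u q' * Tq M q' x q u"

definition ind_safe :: "('n::finite, 'q, 'u, 'yx, 'yq) hybrid \<Rightarrow> ('n, 'q) sfun" where
  "ind_safe M = indicator (safe M)"

definition ip :: "('n::finite, 'q::finite) sfun \<Rightarrow> ('n, 'q) sfun \<Rightarrow> real" where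
  "ip f g = (\<Sum>q\<in>UNIV. LINT x|lborel. f (x, q) * g (x, q))"

definition norm1 :: "('n::finite, 'q::finite) sfun \<Rightarrow> ennreal" where
  "norm1 f = (\<Sum>q\<in>UNIV. \<integral>\<^sup>+ x. ennreal \<bar>f (x, q)\<bar> \<partial>lborel)"

definition n_obs :: "('n, 'q, 'u, 'yx::finite, 'yq::finite) hybrid \<Rightarrow> real" where
  "n_obs M = real CARD('yq) * real CARD('yx)"

definition Phi ::
  "('n::finite, 'q::finite, 'u, 'yx::finite, 'yq::finite) hybrid \<Rightarrow> 'yx \<times> 'yq \<Rightarrow> 'u
     \<Rightarrow> ('n, 'q) sfun \<Rightarrow> ('n, 'q) sfun" where
  "Phi M y u \<sigma> = (\<lambda>(x', q').
     n_obs M * Qobs M q' (snd y) u * phi M (fst y) x' u *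
     (\<Sum>q\<in>UNIV. LINT x|lborel. ind_safe M (x, q) * tau M x' q' x q u * \<sigma> (x, q)))"

definition init_density ::
  "('n::finite, 'q::finite, 'u, 'yx, 'yq) hybrid \<Rightarrow> ('n, 'q) sfun \<Rightarrow> bool" where
  "init_density M \<rho> \<longleftrightarrow>
     (\<forall>s. 0 \<le> \<rho> s) \<and> (\<forall>x q. x \<notin> Xset M \<longrightarrow> \<rho> (x, q) = 0) \<and>
     (\<forall>q. integrable lborel (\<lambda>x. \<rho> (x, q))) \<and>
     (\<Sum>q\<in>UNIV. LINT x|lborel. \<rho> (x, q)) = 1"

inductive_set Sigma_stat ::
  "('n::finite, 'q::finite, 'u, 'yx::finite, 'yq::finite) hybrid \<Rightarrow> ('n, 'q) sfun set"
  for M :: "('n, 'q, 'u, 'yx, 'yq) hybrid" where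
  init: "init_density M \<rho> \<Longrightarrow> \<rho> \<in> Sigma_stat M"
| step: "\<sigma> \<in> Sigma_stat M \<Longrightarrow> Phi M y u \<sigma> \<in> Sigma_stat M"

text \<open>
  \<open>\<Phi>\<close> does not normalise, so \<open>\<Sigma>\<close> may be unbounded in the 1-norm; suprema over \<open>\<Sigma>\<close> are therefore
  taken in \<^typ>\<open>ennreal\<close>, where \<open>0 * \<infinity> = 0\<close>.
\<close>

definition sup_norm ::
  "('n::finite, 'q::finite, 'u, 'yx::finite, 'yq::finite) hybrid \<Rightarrow> (('n, 'q) sfun \<Rightarrow> real)
     \<Rightarrow> ennreal" where
  "sup_norm M V = (SUP \<sigma>\<in>Sigma_stat M. ennreal \<bar>V \<sigma>\<bar>)"

definition sample_density ::
  "('n::finite, 'q::finite, 'u, 'yx::finite, 'yq::finite) hybrid \<Rightarrow> ('n, 'q) sfun set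
     \<Rightarrow> ennreal" where
  "sample_density M S = (SUP \<sigma>\<in>Sigma_stat M. INF \<sigma>'\<in>S. norm1 (\<lambda>s. \<sigma>' s - \<sigma> s))"

definition H_op ::
  "('n::finite, 'q::finite, 'u::finite, 'yx::finite, 'yq::finite) hybrid
     \<Rightarrow> (('n, 'q) sfun \<Rightarrow> real) \<Rightarrow> ('n, 'q) sfun \<Rightarrow> real" where
  "H_op M V \<sigma> = (SUP u. 1 / n_obs M * (\<Sum>y\<in>UNIV. V (Phi M y u \<sigma>)))"

definition V_star ::
  "('n::finite, 'q::finite, 'u::finite, 'yx::finite, 'yq::finite) hybrid
     \<Rightarrow> nat \<Rightarrow> nat \<Rightarrow> ('n, 'q) sfun \<Rightarrow> real" where
  "V_star M T t = (H_op M ^^ (T - t)) (\<lambda>\<sigma>. ip \<sigma> (ind_safe M))"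

lemma V_star_horizon: "V_star M T T = (\<lambda>\<sigma>. ip \<sigma> (ind_safe M))"
  by (simp add: V_star_def)

lemma V_star_backward: "t < T \<Longrightarrow> V_star M T t = H_op M (V_star M T (Suc t))"
  by (simp add: V_star_def Suc_diff_Suc flip: funpow.simps(2)[THEN fun_cong, unfolded comp_apply])

definition back_alpha ::
  "('n::finite, 'q::finite, 'u, 'yx, 'yq) hybrid \<Rightarrow> 'yx \<times> 'yq \<Rightarrow> 'u
     \<Rightarrow> ('n, 'q) sfun \<Rightarrow> ('n, 'q) sfun" where
  "back_alpha M y u \<alpha> = (\<lambda>(x, q). ind_safe M (x, q) *
     (\<Sum>q'\<in>UNIV. LINT x'|lborel.
        \<alpha> (x', q') * Qobs M q' (snd y) u * phi M (fst y) x' u * tau M x' q' x q u))"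

text \<open>
  The maximiser need not be unique, so one backup step is a relation: \<open>sel y u \<sigma>\<close> is any
  maximising element of \<open>\<Gamma>\<close>.
\<close>

definition pb_backup ::
  "('n::finite, 'q::finite, 'u::finite, 'yx::finite, 'yq::finite) hybrid \<Rightarrow> ('n, 'q) sfun set
     \<Rightarrow> ('n, 'q) sfun set \<Rightarrow> ('n, 'q) sfun set \<Rightarrow> bool" where
  "pb_backup M S \<Gamma> \<Gamma>' \<longleftrightarrow>
     (\<exists>sel. (\<forall>y u. \<forall>\<sigma>\<in>S.
          is_arg_max (\<lambda>\<alpha>. ip (back_alpha M y u \<alpha>) \<sigma>) (\<lambda>\<alpha>. \<alpha> \<in> \<Gamma>) (sel y u \<sigma>)) \<and>
        \<Gamma>' = (\<Union>\<sigma>\<in>S. range (\<lambda>u s. \<Sum>y\<in>UNIV. back_alpha M y u (sel y u \<sigma>) s)))"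

definition pb_sets ::
  "('n::finite, 'q::finite, 'u::finite, 'yx::finite, 'yq::finite) hybrid \<Rightarrow> ('n, 'q) sfun set
     \<Rightarrow> nat \<Rightarrow> (nat \<Rightarrow> ('n, 'q) sfun set) \<Rightarrow> bool" where
  "pb_sets M S T \<Gamma> \<longleftrightarrow>
     \<Gamma> T = {ind_safe M} \<and> (\<forall>t<T. pb_backup M S (\<Gamma> (Suc t)) (\<Gamma> t))"

definition V_pb :: "('n::finite, 'q::finite) sfun set \<Rightarrow> ('n, 'q) sfun \<Rightarrow> real" where
  "V_pb \<Gamma> \<sigma> = Max ((\<lambda>\<alpha>. ip \<alpha> \<sigma>) ` \<Gamma>)"

lemma pb_backup_finite:
  assumes "pb_backup M S \<Gamma> \<Gamma>'" "finite S" "S \<noteq> {}"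
  shows "finite \<Gamma>' \<and> \<Gamma>' \<noteq> {}"
  using assms by (auto simp: pb_backup_def)

lemma pb_backup_exists:
  assumes "finite \<Gamma>" "\<Gamma> \<noteq> {}"
  shows "\<exists>\<Gamma>'. pb_backup M S \<Gamma> \<Gamma>'"
proof -
  have "\<exists>\<alpha>. is_arg_max (\<lambda>\<alpha>. ip (back_alpha M y u \<alpha>) \<sigma>) (\<lambda>\<alpha>. \<alpha> \<in> \<Gamma>) \<alpha>" for y u \<sigma>
  proof -
    let ?f = "\<lambda>\<alpha>. ip (back_alpha M y u \<alpha>) \<sigma>"
    have "Max (?f ` \<Gamma>) \<in> ?f ` \<Gamma>"
      using assms by (intro Max_in) auto
    then obtain \<alpha> where "\<alpha> \<in> \<Gamma>" "?f \<alpha> = Max (?f ` \<Gamma>)"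
      by force
    then show ?thesis
      using assms by (intro exI[of _ \<alpha>]) (auto simp: is_arg_max_linorder)
  qed
  then obtain sel where "\<And>y u \<sigma>. is_arg_max (\<lambda>\<alpha>. ip (back_alpha M y u \<alpha>) \<sigma>) (\<lambda>\<alpha>. \<alpha> \<in> \<Gamma>) (sel y u \<sigma>)"
    by metis
  then show ?thesis
    unfolding pb_backup_def by blast
qed

lemma pb_sets_exists:
  assumes "finite S" "S \<noteq> {}"
  shows "\<exists>\<Gamma>. pb_sets M S T \<Gamma>"
proof -
  define P where "P = (\<lambda>(k::nat) \<Gamma>. finite \<Gamma> \<and> \<Gamma> \<noteq> {} \<and> (k = 0 \<longrightarrow> \<Gamma> = {ind_safe M}))"
  have "\<exists>f. \<forall>k. P k (f k) \<and> pb_backup M S (f k) (f (Suc k))"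
  proof (rule dependent_nat_choice)
    show "\<exists>\<Gamma>. P 0 \<Gamma>"
      by (auto simp: P_def)
  next
    fix \<Gamma> k assume "P k \<Gamma>"
    then show "\<exists>\<Gamma>'. P (Suc k) \<Gamma>' \<and> pb_backup M S \<Gamma> \<Gamma>'"
      using pb_backup_exists[of \<Gamma> M S] pb_backup_finite[OF _ assms] by (auto simp: P_def)
  qed
  then obtain f where f: "\<And>k. P k (f k)" "\<And>k. pb_backup M S (f k) (f (Suc k))"
    by blast
  have "pb_backup M S (f (T - Suc t)) (f (T - t))" if "t < T" for t
    using f(2)[of "T - Suc t"] that by (simp add: Suc_diff_Suc)
  then have "pb_sets M S T (\<lambda>t. f (T - t))"
    using f(1)[of 0] by (simp add: pb_sets_def P_def)
  then show ?thesis
    by (rule exI[where P = "pb_sets M S T"])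
qed

end

theory Submission imports Defs begin

text \<open>
  All \<open>\<alpha>\<close>-functions take values in \<open>[0, 1]\<close>, and \<open>\<langle>\<alpha>, \<Phi>\<^sub>y\<^sub>,\<^sub>u \<sigma>\<rangle>\<close> is \<open>n_obs M\<close> times the pairing of the
  backed-up \<open>\<alpha>\<close> with \<open>\<sigma>\<close> by Fubini, so the exact backup of a point-based value function is again a
  maximum of pairings with \<open>[0, 1]\<close>-valued functions. Let \<open>\<alpha>\<close> be the exact maximiser at \<open>\<sigma>\<close> and \<open>\<beta>\<close>
  the one selected at a sample \<open>\<sigma>'\<close>. As \<open>\<beta>\<close> is optimal at \<open>\<sigma>'\<close>, one backup loses at most
  \<open>\<langle>\<alpha> - \<beta>, \<sigma> - \<sigma>'\<rangle> \<le> \<parallel>\<sigma> - \<sigma>'\<parallel>\<^sub>1\<close>. The exact backup averages over the \<open>n_obs M\<close> observations and is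
  therefore nonexpansive in the supremum norm, although \<open>\<Phi>\<close> does not normalise; the losses add up.
\<close>

section \<open>Pairings of functions with values in [0, 1] and integrable functions\<close>

definition unit_fun :: "('n::finite, 'q) sfun \<Rightarrow> bool" where
  "unit_fun \<alpha> \<longleftrightarrow>
     (\<forall>q. (\<lambda>x. \<alpha> (x, q)) \<in> borel_measurable borel) \<and> (\<forall>s. 0 \<le> \<alpha> s \<and> \<alpha> s \<le> 1)"

text \<open>No bound on the total mass is imposed: \<open>Phi\<close> carries the factor
  \<open>n_obs M\<close>, so iterating it can increase the 1-norm.\<close>

definition nonneg_integrable :: "('n::finite, 'q) sfun \<Rightarrow> bool" where
  "nonneg_integrable \<sigma> \<longleftrightarrow> (\<forall>q. integrable lborel (\<lambda>x. \<sigma> (x, q))) \<and> (\<forall>s. 0 \<le> \<sigma> s)"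

lemma integrable_bounded_mult:
  fixes f g :: "'a \<Rightarrow> real"
  assumes "integrable M g" "f \<in> borel_measurable M" "\<And>x. \<bar>f x\<bar> \<le> 1"
  shows "integrable M (\<lambda>x. f x * g x)"
proof (rule Bochner_Integration.integrable_bound[OF assms(1)])
  show "(\<lambda>x. f x * g x) \<in> borel_measurable M"
    using assms(1,2) by measurable
  show "AE x in M. norm (f x * g x) \<le> norm (g x)"
    using mult_right_mono[OF assms(3) abs_ge_zero] by (simp add: abs_mult)
qed

lemma integrable_unit_fun_mult:
  assumes "unit_fun \<alpha>" "nonneg_integrable \<sigma>"
  shows "integrable lborel (\<lambda>x. \<alpha> (x, q) * \<sigma> (x, q))"
  using assms by (intro integrable_bounded_mult) (auto simp: unit_fun_def nonneg_integrable_def)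

text \<open>Integrability of the inner integrals accompanies the exchange, since the finite sums
  over modes are later pulled through the outer integral, which needs integrable summands.\<close>

lemma integral_eq_iterated:
  fixes f :: "'a::euclidean_space \<Rightarrow> 'b::euclidean_space \<Rightarrow> real"
  assumes "integrable (lborel \<Otimes>\<^sub>M lborel) (\<lambda>(x, y). f x y)"
  shows "integrable lborel (\<lambda>x. LINT y|lborel. f x y)"
    and "integrable lborel (\<lambda>y. LINT x|lborel. f x y)"
    and "(LINT x|lborel. LINT y|lborel. f x y) = (LINT y|lborel. LINT x|lborel. f x y)"
  using lborel_pair.integrable_fst[OF assms] lborel_pair.integrable_snd[OF assms]
    lborel_pair.Fubini_integral[OF assms] by auto

lemma ip_commute: "ip f g = ip g f"
  by (simp add: ip_def mult.commute)

lemma ip_sum_left: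
  assumes "\<And>y q. y \<in> A \<Longrightarrow> integrable lborel (\<lambda>x. f y (x, q) * \<sigma> (x, q))"
  shows "ip (\<lambda>s. \<Sum>y\<in>A. f y s) \<sigma> = (\<Sum>y\<in>A. ip (f y) \<sigma>)"
  using assms unfolding ip_def
  by (subst sum.swap) (simp add: sum_distrib_right Bochner_Integration.integral_sum)

lemma norm1_eq_ennreal:
  assumes "\<And>q. integrable lborel (\<lambda>x. f (x, q))"
  shows "norm1 f = ennreal (\<Sum>q\<in>UNIV. LINT x|lborel. \<bar>f (x, q)\<bar>)"
  unfolding norm1_def using assms
  by (subst sum_ennreal[symmetric]) (auto simp: nn_integral_eq_integral)

text \<open>Adding the nonnegative gap at \<sigma>' leaves the pairing of \<alpha> - \<beta> with
  \<sigma> - \<sigma>', to which Hoelder's inequality applies. Two values in [0, 1] differ by at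
  most 1, which gives the constant 1 in front of the 1-norm distance.\<close>

lemma ip_difference_le:
  assumes "unit_fun \<alpha>" "unit_fun \<beta>" "nonneg_integrable \<sigma>" "nonneg_integrable \<sigma>'"
    and "ip \<alpha> \<sigma>' \<le> ip \<beta> \<sigma>'"
  shows "ip \<alpha> \<sigma> - ip \<beta> \<sigma> \<le> (\<Sum>q\<in>UNIV. LINT x|lborel. \<bar>\<sigma>' (x, q) - \<sigma> (x, q)\<bar>)"
proof -
  note int = assms(1,2)[THEN integrable_unit_fun_mult, OF assms(3)]
    assms(1,2)[THEN integrable_unit_fun_mult, OF assms(4)]
  have "ip \<alpha> \<sigma> - ip \<beta> \<sigma> \<le> ip \<alpha> \<sigma> - ip \<beta> \<sigma> - ip \<alpha> \<sigma>' + ip \<beta> \<sigma>'"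
    using assms(5) by simp
  also have "\<dots> = (\<Sum>q\<in>UNIV. LINT x|lborel. (\<alpha> (x, q) - \<beta> (x, q)) * (\<sigma> (x, q) - \<sigma>' (x, q)))"
    using int by (simp add: ip_def left_diff_distrib right_diff_distrib sum_subtractf)
  also have "\<dots> \<le> (\<Sum>q\<in>UNIV. LINT x|lborel. \<bar>\<sigma>' (x, q) - \<sigma> (x, q)\<bar>)"
  proof (intro sum_mono integral_mono)
    fix q x
    have "(\<alpha> (x, q) - \<beta> (x, q)) * (\<sigma> (x, q) - \<sigma>' (x, q))
        \<le> \<bar>\<alpha> (x, q) - \<beta> (x, q)\<bar> * \<bar>\<sigma> (x, q) - \<sigma>' (x, q)\<bar>"
      by (metis abs_ge_self abs_mult)
    also have "\<bar>\<alpha> (x, q) - \<beta> (x, q)\<bar> \<le> 1"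
      using assms(1,2)[unfolded unit_fun_def] by (smt (verit))
    finally show "(\<alpha> (x, q) - \<beta> (x, q)) * (\<sigma> (x, q) - \<sigma>' (x, q)) \<le> \<bar>\<sigma>' (x, q) - \<sigma> (x, q)\<bar>"
      by (simp add: abs_minus_commute mult_right_mono)
  next
    show "integrable lborel (\<lambda>x. (\<alpha> (x, q) - \<beta> (x, q)) * (\<sigma> (x, q) - \<sigma>' (x, q)))" for q
      using int by (simp add: left_diff_distrib right_diff_distrib)
    show "integrable lborel (\<lambda>x. \<bar>\<sigma>' (x, q) - \<sigma> (x, q)\<bar>)" for q
      using assms(3,4) by (simp add: nonneg_integrable_def)
  qed
  finally show ?thesis .
qed

section \<open>Elementary bounds on kernels and observation probabilities\<close>

locale hybrid_sys =
  fixes M :: "('n::finite, 'q::finite, 'u::finite, 'yx::finite, 'yq::finite) hybrid"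
  assumes hybrid: "hybrid_system M"
begin

text \<open>Extension by zero makes nonnegativity hold on the whole space. For \<open>phi\<close>
  the weaker bound by 1 is stated at every point, since successors drawn from \<open>Tx\<close> may
  lie outside \<open>Xset M\<close>.\<close>

lemma
  shows safe_Xset: "(x, q) \<in> safe M \<Longrightarrow> x \<in> Xset M"
    and Tx_measurable: "(\<lambda>(x', x). Tx M x' x u q') \<in> borel_measurable (borel \<Otimes>\<^sub>M borel)"
    and Tx_nonneg: "0 \<le> Tx M x' x u q'"
    and Tx_integral: "x \<in> Xset M \<Longrightarrow> has_bochner_integral lborel (\<lambda>x'. Tx M x' x u q') 1"
    and Tx_outside: "x \<notin> Xset M \<Longrightarrow> Tx M x' x u q' = 0"
    and Tq_measurable[measurable]: "(\<lambda>x. Tq M q' x q u) \<in> borel_measurable borel"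
    and Tq_nonneg: "0 \<le> Tq M q' x q u"
    and Tq_sum: "x \<in> Xset M \<Longrightarrow> (\<Sum>q'\<in>UNIV. Tq M q' x q u) = 1"
    and Qobs_nonneg: "0 \<le> Qobs M q yq u"
    and Qobs_sum: "(\<Sum>yq\<in>UNIV. Qobs M q yq u) = 1"
    and phi_measurable[measurable]: "(\<lambda>x. phi M yx x u) \<in> borel_measurable borel"
    and phi_nonneg: "0 \<le> phi M yx x u"
    and phi_sum: "(\<Sum>yx\<in>UNIV. phi M yx x u) \<le> 1"
  using hybrid unfolding hybrid_system_def by (cases "x \<in> Xset M"; auto)+

lemma unit_fun_ind_safe: "unit_fun (ind_safe M)"
proof -
  have [measurable]: "safe M \<in> sets (borel \<Otimes>\<^sub>M count_space UNIV)"
    using hybrid unfolding hybrid_system_def by blast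
  show ?thesis
    unfolding unit_fun_def ind_safe_def by (auto simp: indicator_def)
qed

lemma n_obs_pos: "n_obs M > 0"
  by (simp add: n_obs_def)

lemma Qobs_le_1: "Qobs M q yq u \<le> 1"
  using member_le_sum[of yq UNIV "\<lambda>yq. Qobs M q yq u"] Qobs_nonneg Qobs_sum by simp

lemma phi_le_1: "phi M yx x u \<le> 1"
  using member_le_sum[of yx UNIV "\<lambda>yx. phi M yx x u"] phi_nonneg order_trans[OF _ phi_sum] by simp

lemma Tq_le_1: "Tq M q' x q u \<le> 1"
proof (cases "x \<in> Xset M")
  case True
  then show ?thesis
    using member_le_sum[of q' UNIV "\<lambda>q'. Tq M q' x q u"] Tq_nonneg Tq_sum by simp
next
  case False
  then show ?thesis
    using hybrid unfolding hybrid_system_def by simp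
qed

text \<open>The observation weight is a product over the two components, so the sum factors; the sum
  over \<open>yq\<close> is 1, and only the sum over \<open>yx\<close> can fall short, outside
  \<open>Xset M\<close>.\<close>

lemma obs_sum_le_1: "(\<Sum>y\<in>UNIV. Qobs M q (snd y) u * phi M (fst y) x u) \<le> 1"
proof -
  have "(\<Sum>y\<in>UNIV. Qobs M q (snd y) u * phi M (fst y) x u)
      = (\<Sum>yx\<in>UNIV. \<Sum>yq\<in>UNIV. Qobs M q yq u * phi M yx x u)"
    by (simp add: sum.cartesian_product split_beta flip: UNIV_Times_UNIV)
  also have "\<dots> = (\<Sum>yx\<in>UNIV. phi M yx x u)"
    by (simp add: Qobs_sum flip: sum_distrib_right)
  finally show ?thesis
    using phi_sum by simp
qed

section \<open>Integrability of the transition kernel and the exchange of integrals\<close>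

lemma integrable_Tx: "integrable lborel (\<lambda>x'. Tx M x' x u q')"
  using Tx_integral[of x u q'] Tx_outside[of x _ u q'] by (cases "x \<in> Xset M") (auto intro: integrable.intros)

lemma integral_Tx_le_1: "(LINT x'|lborel. Tx M x' x u q') \<le> 1"
  using Tx_integral[of x u q'] Tx_outside[of x _ u q']
  by (cases "x \<in> Xset M") (auto simp: has_bochner_integral_integral_eq)

text \<open>Tonelli's criterion with \<open>x'\<close> integrated first: for fixed \<open>x\<close>,
  \<open>Tx\<close> has mass at most 1 in \<open>x'\<close>, so the inner integral of the absolute
  value is at most \<bar>h x\<bar>. The other order would not do, as nothing bounds the integral of
  \<open>Tx\<close> over \<open>x\<close>.\<close>

lemma integrable_kernel:
  assumes h: "integrable lborel h" and f: "f \<in> borel_measurable borel" "\<And>x. \<bar>f x\<bar> \<le> (1::real)"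
  shows "integrable (lborel \<Otimes>\<^sub>M lborel) (\<lambda>(x', x). f x' * Tx M x' x u q' * h x)"
proof -
  let ?g = "\<lambda>x x'. f x' * Tx M x' x u q' * h x"
  have [measurable]: "f \<in> borel_measurable lborel" "h \<in> borel_measurable lborel"
    using f(1) h by auto
  have "sets (lborel \<Otimes>\<^sub>M lborel :: ((real ^ 'n) \<times> (real ^ 'n)) measure) = sets (borel \<Otimes>\<^sub>M borel)"
    by (intro sets_pair_measure_cong) auto
  then have [measurable]: "(\<lambda>z. Tx M (fst z) (snd z) u q') \<in> borel_measurable (lborel \<Otimes>\<^sub>M lborel)"
    using Tx_measurable[of u q'] by (simp add: split_beta' cong: measurable_cong_sets)
  have fT: "integrable lborel (\<lambda>x'. f x' * Tx M x' x u q')" for x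
    by (intro integrable_bounded_mult integrable_Tx f) simp
  have meas: "(\<lambda>(x', x). ?g x x') \<in> borel_measurable (lborel \<Otimes>\<^sub>M lborel)"
    unfolding split_beta by measurable
  \<comment> \<open>\<open>Fubini_integrable\<close> takes the inner integral over the second
    component, hence the pair is swapped here and swapped back once the criterion has been
    applied.\<close>
  then have meas': "(\<lambda>(x, x'). ?g x x') \<in> borel_measurable (lborel \<Otimes>\<^sub>M lborel)"
    using measurable_compose[OF measurable_pair_swap' meas] by (simp add: split_beta')
  have "integrable (lborel \<Otimes>\<^sub>M lborel) (\<lambda>(x, x'). ?g x x')"
  proof (rule lborel_pair.Fubini_integrable[OF meas'])
    show "AE x in lborel. integrable lborel (\<lambda>x'. case (x, x') of (x, x') \<Rightarrow> ?g x x')"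
      using fT by simp
    show "integrable lborel (\<lambda>x. LINT x'|lborel. norm (case (x, x') of (x, x') \<Rightarrow> ?g x x'))"
    proof (rule Bochner_Integration.integrable_bound[OF h])
      show "(\<lambda>x. LINT x'|lborel. norm (case (x, x') of (x, x') \<Rightarrow> ?g x x')) \<in> borel_measurable lborel"
        using meas' by (intro lborel.borel_measurable_lebesgue_integral) (auto simp: split_beta)
      have "(LINT x'|lborel. \<bar>f x' * Tx M x' x u q'\<bar>) \<le> 1" for x
      proof -
        have "(LINT x'|lborel. \<bar>f x' * Tx M x' x u q'\<bar>) \<le> (LINT x'|lborel. Tx M x' x u q')"
          by (intro integral_mono integrable_abs fT integrable_Tx)
             (simp add: abs_mult Tx_nonneg f(2) mult_left_le_one_le)
        then show ?thesis
          using integral_Tx_le_1 order_trans by blast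
      qed
      then have "(LINT x'|lborel. \<bar>f x' * Tx M x' x u q'\<bar>) * \<bar>h x\<bar> \<le> \<bar>h x\<bar>" for x
        by (simp add: mult_left_le_one_le)
      then show "AE x in lborel. norm (LINT x'|lborel. norm (case (x, x') of (x, x') \<Rightarrow> ?g x x')) \<le> norm (h x)"
        by (simp add: abs_mult[of _ "h _"])
    qed
  qed
  from lborel_pair.integrable_product_swap[OF this] show ?thesis
    by (simp add: split_beta)
qed

lemma integrable_weight:
  assumes \<sigma>: "nonneg_integrable \<sigma>"
  shows "integrable lborel (\<lambda>x. ind_safe M (x, q) * Tq M q' x q u * \<sigma> (x, q))"
proof (rule integrable_bounded_mult)
  have [measurable]: "(\<lambda>x. ind_safe M (x, q)) \<in> borel_measurable borel"
    using unit_fun_ind_safe by (simp add: unit_fun_def)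
  show "(\<lambda>x. ind_safe M (x, q) * Tq M q' x q u) \<in> borel_measurable lborel"
    by measurable
  show "\<bar>ind_safe M (x, q) * Tq M q' x q u\<bar> \<le> 1" for x
    using unit_fun_ind_safe by (auto simp: unit_fun_def abs_mult Tq_nonneg Tq_le_1 intro!: mult_le_one)
qed (use \<sigma> in \<open>simp add: nonneg_integrable_def\<close>)

text \<open>These factors depend on the successor \<open>x'\<close> alone and serve as
  \<open>f\<close> in \<open>integrable_kernel\<close>; those of \<open>integrable_weight\<close>
  depend on the predecessor \<open>x\<close> alone and serve as \<open>h\<close>.\<close>

lemma
  assumes "unit_fun \<alpha>"
  shows obs_weight_measurable: "(\<lambda>x'. \<alpha> (x', q') * Qobs M q' yq u * phi M yx x' u) \<in> borel_measurable borel"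
    and obs_weight_abs_le_1: "\<bar>\<alpha> (x', q') * Qobs M q' yq u * phi M yx x' u\<bar> \<le> 1"
proof -
  have [measurable]: "(\<lambda>x. \<alpha> (x, q')) \<in> borel_measurable borel"
    using assms by (simp add: unit_fun_def)
  show "(\<lambda>x'. \<alpha> (x', q') * Qobs M q' yq u * phi M yx x' u) \<in> borel_measurable borel"
    by measurable
  show "\<bar>\<alpha> (x', q') * Qobs M q' yq u * phi M yx x' u\<bar> \<le> 1"
    using assms by (auto simp: unit_fun_def abs_mult Qobs_nonneg Qobs_le_1 phi_nonneg phi_le_1 intro!: mult_le_one)
qed

lemma integrable_weighted_kernel:
  assumes \<sigma>: "nonneg_integrable \<sigma>" and \<alpha>: "unit_fun \<alpha>"
  shows "integrable (lborel \<Otimes>\<^sub>M lborel) (\<lambda>(x', x).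
    \<alpha> (x', q') * Qobs M q' yq u * phi M yx x' u * Tx M x' x u q' * (ind_safe M (x, q) * Tq M q' x q u * \<sigma> (x, q)))"
  by (intro integrable_kernel integrable_weight obs_weight_measurable obs_weight_abs_le_1 assms)

lemma nonneg_integrable_Phi:
  assumes \<sigma>: "nonneg_integrable \<sigma>"
  shows "nonneg_integrable (Phi M y u \<sigma>)"
proof -
  \<comment> \<open>With the constant 1 in place of \<alpha>, the weighted kernel is the integrand
    of \<open>Phi\<close> up to the factor \<open>n_obs M\<close>.\<close>
  have "unit_fun (\<lambda>_. 1 :: real)"
    by (simp add: unit_fun_def)
  note int = integral_eq_iterated(1)[OF integrable_weighted_kernel[OF \<sigma> this]]
  have "integrable lborel (\<lambda>x'. Phi M y u \<sigma> (x', q'))" for q'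
  proof -
    have "Phi M y u \<sigma> (x', q') = n_obs M * (\<Sum>q\<in>UNIV. LINT x|lborel.
        1 * Qobs M q' (snd y) u * phi M (fst y) x' u * Tx M x' x u q'
          * (ind_safe M (x, q) * Tq M q' x q u * \<sigma> (x, q)))" for x'
      unfolding Phi_def tau_def
      by (simp add: sum_distrib_left mult_ac flip: integral_mult_right_zero)
    then show ?thesis
      using int[of q' "snd y" u "fst y"] by simp
  qed
  moreover have "0 \<le> Phi M y u \<sigma> s" for s
    using n_obs_pos unit_fun_ind_safe \<sigma>
    by (cases s) (auto simp: Phi_def tau_def unit_fun_def nonneg_integrable_def Qobs_nonneg phi_nonneg
        Tx_nonneg Tq_nonneg intro!: mult_nonneg_nonneg sum_nonneg integral_nonneg)
  ultimately show ?thesis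
    by (simp add: nonneg_integrable_def)
qed

lemma nonneg_integrable_Sigma_stat: "\<sigma> \<in> Sigma_stat M \<Longrightarrow> nonneg_integrable \<sigma>"
  by (induction rule: Sigma_stat.induct)
     (auto simp: init_density_def nonneg_integrable_Phi, simp add: nonneg_integrable_def)

text \<open>Adjointness of \<open>Phi\<close> and \<open>back_alpha\<close> up to a factor: both
  pairings integrate the same \<open>f\<close>, once with the successor outside and once with the
  predecessor outside.\<close>

lemma ip_Phi:
  assumes \<sigma>: "nonneg_integrable \<sigma>" and \<alpha>: "unit_fun \<alpha>"
  shows "ip \<alpha> (Phi M y u \<sigma>) = n_obs M * ip (back_alpha M y u \<alpha>) \<sigma>"
proof -
  define f where "f q' q x' x = \<alpha> (x', q') * Qobs M q' (snd y) u * phi M (fst y) x' u * Tx M x' x u q'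
    * (ind_safe M (x, q) * Tq M q' x q u * \<sigma> (x, q))" for q' q x' x
  note F = integral_eq_iterated[OF integrable_weighted_kernel[OF \<sigma> \<alpha>, of _ "snd y" u "fst y", folded f_def]]
  have "\<alpha> (x', q') * Phi M y u \<sigma> (x', q') = n_obs M * (\<Sum>q\<in>UNIV. LINT x|lborel. f q' q x' x)" for x' q'
    unfolding Phi_def tau_def f_def
    by (simp add: sum_distrib_left mult_ac flip: integral_mult_right_zero)
  then have "ip \<alpha> (Phi M y u \<sigma>) = n_obs M * (\<Sum>q'\<in>UNIV. \<Sum>q\<in>UNIV. LINT x'|lborel. LINT x|lborel. f q' q x' x)"
    using F(1) by (simp add: ip_def sum_distrib_left)
  also have "\<dots> = n_obs M * (\<Sum>q\<in>UNIV. \<Sum>q'\<in>UNIV. LINT x|lborel. LINT x'|lborel. f q' q x' x)"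
    by (subst sum.swap) (simp only: F(3))
  also have "\<dots> = n_obs M * (\<Sum>q\<in>UNIV. LINT x|lborel. (\<Sum>q'\<in>UNIV. LINT x'|lborel. f q' q x' x))"
    using F(2) by simp
  also have "\<dots> = n_obs M * ip (back_alpha M y u \<alpha>) \<sigma>"
    unfolding ip_def back_alpha_def tau_def f_def
    by (simp add: sum_distrib_left sum_distrib_right mult_ac
        flip: integral_mult_right_zero integral_mult_left_zero)
  finally show ?thesis .
qed

section \<open>Range of the backed-up functions\<close>

lemma back_alpha_measurable:
  assumes "unit_fun \<alpha>"
  shows "(\<lambda>x. back_alpha M y u \<alpha> (x, q)) \<in> borel_measurable borel"
proof -
  have [measurable]: "(\<lambda>x. ind_safe M (x, q)) \<in> borel_measurable borel"
    "\<And>q'. (\<lambda>x. \<alpha> (x, q')) \<in> borel_measurable borel"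
    using assms unit_fun_ind_safe by (auto simp: unit_fun_def)
  have [measurable]: "(\<lambda>(x, x'). Tx M x' x u q') \<in> borel_measurable (borel \<Otimes>\<^sub>M borel)" for q'
    using Tx_measurable measurable_compose[OF measurable_pair_swap' Tx_measurable[of u q']] by simp
  have "(\<lambda>x. LINT x'|lborel. \<alpha> (x', q') * Qobs M q' (snd y) u * phi M (fst y) x' u * tau M x' q' x q u)
      \<in> borel_measurable borel" for q'
    unfolding tau_def by measurable
  then show ?thesis
    unfolding back_alpha_def by simp
qed

lemma
  assumes "unit_fun \<alpha>"
  shows back_alpha_integrable: "integrable lborel (\<lambda>x'.
        \<alpha> (x', q') * Qobs M q' (snd y) u * phi M (fst y) x' u * tau M x' q' x q u)"
    and back_alpha_nonneg: "0 \<le> back_alpha M y u \<alpha> s"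
proof -
  have "integrable lborel (\<lambda>x'. (\<alpha> (x', q') * Qobs M q' (snd y) u * phi M (fst y) x' u) * Tx M x' x u q')"
    by (intro integrable_bounded_mult integrable_Tx obs_weight_abs_le_1 assms)
       (simp add: obs_weight_measurable[OF assms])
  then show "integrable lborel (\<lambda>x'.
      \<alpha> (x', q') * Qobs M q' (snd y) u * phi M (fst y) x' u * tau M x' q' x q u)"
    unfolding tau_def mult.assoc[symmetric] by (rule integrable_mult_left)
  show "0 \<le> back_alpha M y u \<alpha> s"
    using assms unit_fun_ind_safe
    by (cases s) (auto simp: back_alpha_def tau_def unit_fun_def Qobs_nonneg phi_nonneg Tx_nonneg Tq_nonneg
        intro!: mult_nonneg_nonneg sum_nonneg integral_nonneg)
qed

text \<open>Summing over all observations removes the observation weights, whose total is at most 1,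
  and leaves the mass of \<open>tau\<close> over all successors, which is 1. \<open>A\<close>
  depends on \<open>y\<close> because a separate function is selected for each observation.\<close>

lemma back_alpha_sum_le_1:
  assumes A: "\<And>y. unit_fun (A y)"
  shows "(\<Sum>y\<in>UNIV. back_alpha M y u (A y) s) \<le> 1"
proof (cases "s \<in> safe M")
  case False
  then show ?thesis
    by (simp add: back_alpha_def ind_safe_def split_beta)
next
  case True
  obtain x q where s: "s = (x, q)"
    by fastforce
  with True have x: "x \<in> Xset M"
    using safe_Xset by blast
  let ?w = "\<lambda>y q' x'. A y (x', q') * Qobs M q' (snd y) u * phi M (fst y) x' u"
  have w: "(\<Sum>y\<in>UNIV. ?w y q' x') \<le> 1" for q' x'
  proof -
    have "(\<Sum>y\<in>UNIV. ?w y q' x') \<le> (\<Sum>y\<in>UNIV. Qobs M q' (snd y) u * phi M (fst y) x' u)"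
      using A by (intro sum_mono mult_right_mono)
        (auto simp: unit_fun_def Qobs_nonneg phi_nonneg intro!: mult_left_le_one_le)
    then show ?thesis
      using obs_sum_le_1 order_trans by blast
  qed
  have "(\<Sum>y\<in>UNIV. back_alpha M y u (A y) s)
      = (\<Sum>q'\<in>UNIV. \<Sum>y\<in>UNIV. LINT x'|lborel. ?w y q' x' * tau M x' q' x q u)"
    using True by (subst sum.swap) (simp add: back_alpha_def ind_safe_def s)
  also have "\<dots> = (\<Sum>q'\<in>UNIV. LINT x'|lborel. (\<Sum>y\<in>UNIV. ?w y q' x') * tau M x' q' x q u)"
    using back_alpha_integrable[OF A] by (simp add: sum_distrib_right)
  also have "\<dots> \<le> (\<Sum>q'\<in>UNIV. LINT x'|lborel. tau M x' q' x q u)"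
  proof (intro sum_mono integral_mono)
    show "integrable lborel (\<lambda>x'. (\<Sum>y\<in>UNIV. ?w y q' x') * tau M x' q' x q u)" for q'
      using back_alpha_integrable[OF A] by (simp add: sum_distrib_right)
    show "integrable lborel (\<lambda>x'. tau M x' q' x q u)" for q'
      using integrable_Tx by (simp add: tau_def)
    show "(\<Sum>y\<in>UNIV. ?w y q' x') * tau M x' q' x q u \<le> tau M x' q' x q u" for q' x'
      using mult_right_mono[OF w, of "tau M x' q' x q u"] by (simp add: tau_def Tx_nonneg Tq_nonneg)
  qed
  also have "\<dots> = 1"
    using Tq_sum[OF x] by (simp add: tau_def has_bochner_integral_integral_eq[OF Tx_integral[OF x]])
  finally show ?thesis .
qed

text \<open>The invariant of the induction; it applies both to the functions selected at a sample
  and to the exact maximiser at an arbitrary statistic.\<close>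

lemma unit_fun_back_sum:
  assumes "\<And>y. unit_fun (A y)"
  shows "unit_fun (\<lambda>s. \<Sum>y\<in>UNIV. back_alpha M y u (A y) s)"
  using back_alpha_measurable[OF assms] back_alpha_nonneg[OF assms] back_alpha_sum_le_1[OF assms]
  by (auto simp: unit_fun_def intro!: sum_nonneg)

lemma unit_fun_back:
  assumes "unit_fun \<alpha>"
  shows "unit_fun (back_alpha M y u \<alpha>)"
proof -
  have "back_alpha M y u \<alpha> s \<le> (\<Sum>y\<in>UNIV. back_alpha M y u \<alpha> s)" for s
    using back_alpha_nonneg[OF assms] by (intro member_le_sum) auto
  then have "back_alpha M y u \<alpha> s \<le> 1" for s
    using back_alpha_sum_le_1[of "\<lambda>_. \<alpha>"] assms order_trans by blast
  then show ?thesis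
    using back_alpha_measurable[OF assms] back_alpha_nonneg[OF assms] by (simp add: unit_fun_def)
qed

section \<open>Comparison of the exact and the point-based backup\<close>

lemma ip_back_sum:
  assumes "nonneg_integrable \<sigma>" "\<And>y. unit_fun (A y)"
  shows "ip (\<lambda>s. \<Sum>y\<in>UNIV. back_alpha M y u (A y) s) \<sigma> = (\<Sum>y\<in>UNIV. ip (back_alpha M y u (A y)) \<sigma>)"
  using assms by (intro ip_sum_left integrable_unit_fun_mult unit_fun_back)

text \<open>The factor \<open>n_obs M\<close> from \<open>ip_Phi\<close> is positive, so it passes
  through the maximum and cancels against the averaging factor in \<open>H_op\<close>. What is left
  is, per observation, a maximum of the very objective that the selection in
  \<open>pb_backup\<close> maximises.\<close>

lemma H_op_V_pb:
  assumes "nonneg_integrable \<sigma>" "finite G" "G \<noteq> {}" "\<And>\<alpha>. \<alpha> \<in> G \<Longrightarrow> unit_fun \<alpha>"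
  shows "H_op M (V_pb G) \<sigma> = (SUP u. \<Sum>y\<in>UNIV. Max ((\<lambda>\<alpha>. ip (back_alpha M y u \<alpha>) \<sigma>) ` G))"
proof -
  have "V_pb G (Phi M y u \<sigma>) = n_obs M * Max ((\<lambda>\<alpha>. ip (back_alpha M y u \<alpha>) \<sigma>) ` G)" for y u
  proof -
    have "mono (\<lambda>x. n_obs M * x)"
      using n_obs_pos by (auto intro!: monoI)
    from mono_Max_commute[OF this, of "(\<lambda>\<alpha>. ip (back_alpha M y u \<alpha>) \<sigma>) ` G"]
    show ?thesis
      using assms by (simp add: V_pb_def ip_Phi image_image cong: image_cong_simp)
  qed
  then show ?thesis
    using n_obs_pos by (simp add: H_op_def flip: sum_distrib_left)
qed

lemma backup_error:
  assumes G: "finite G" "G \<noteq> {}" "\<And>\<alpha>. \<alpha> \<in> G \<Longrightarrow> unit_fun \<alpha>"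
    and S: "finite S" "\<And>\<sigma>. \<sigma> \<in> S \<Longrightarrow> nonneg_integrable \<sigma>"
    and bk: "pb_backup M S G G'"
    and \<sigma>: "nonneg_integrable \<sigma>" and \<sigma>': "\<sigma>' \<in> S"
  shows "ennreal \<bar>V_pb G' \<sigma> - H_op M (V_pb G) \<sigma>\<bar> \<le> norm1 (\<lambda>s. \<sigma>' s - \<sigma> s)"
proof -
  obtain sel where sel: "\<And>y u \<sigma>. \<sigma> \<in> S \<Longrightarrow>
        is_arg_max (\<lambda>\<alpha>. ip (back_alpha M y u \<alpha>) \<sigma>) (\<lambda>\<alpha>. \<alpha> \<in> G) (sel y u \<sigma>)"
    and G': "G' = (\<Union>\<sigma>\<in>S. range (\<lambda>u s. \<Sum>y\<in>UNIV. back_alpha M y u (sel y u \<sigma>) s))"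
    using bk unfolding pb_backup_def by blast
  have selG: "sel y u \<rho> \<in> G" if "\<rho> \<in> S" for y u \<rho>
    using sel[OF that] by (simp add: is_arg_max_linorder)
  have fin: "finite G'" "G' \<noteq> {}"
    using pb_backup_finite[OF bk S(1)] \<sigma>' by auto
  let ?m = "\<lambda>u. \<Sum>y\<in>UNIV. Max ((\<lambda>\<alpha>. ip (back_alpha M y u \<alpha>) \<sigma>) ` G)"
  let ?d = "\<Sum>q\<in>UNIV. LINT x|lborel. \<bar>\<sigma>' (x, q) - \<sigma> (x, q)\<bar>"
  have H: "H_op M (V_pb G) \<sigma> = (SUP u. ?m u)"
    by (rule H_op_V_pb[OF \<sigma> G])
  have bdd: "bdd_above (range ?m)"
    by (intro bdd_above_finite) auto
  \<comment> \<open>Each member of \<open>G'\<close> is one choice of a function in \<open>G\<close>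
    per observation, so the point-based value never exceeds the exact backup.\<close>
  have "V_pb G' \<sigma> \<le> (SUP u. ?m u)"
    unfolding V_pb_def
  proof (rule Max.boundedI)
    fix a assume "a \<in> (\<lambda>\<alpha>. ip \<alpha> \<sigma>) ` G'"
    then obtain \<rho> u where \<rho>: "\<rho> \<in> S"
      and a: "a = ip (\<lambda>s. \<Sum>y\<in>UNIV. back_alpha M y u (sel y u \<rho>) s) \<sigma>"
      by (auto simp: G')
    have "a = (\<Sum>y\<in>UNIV. ip (back_alpha M y u (sel y u \<rho>)) \<sigma>)"
      unfolding a using selG[OF \<rho>] by (intro ip_back_sum \<sigma> G)
    also have "\<dots> \<le> ?m u"
      using selG[OF \<rho>] G by (intro sum_mono Max_ge) auto
    also have "\<dots> \<le> (SUP u. ?m u)"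
      by (intro cSUP_upper bdd) auto
    finally show "a \<le> (SUP u. ?m u)" .
  qed (use fin in auto)
  moreover have "(SUP u. ?m u) \<le> V_pb G' \<sigma> + ?d"
  proof (rule cSUP_least)
    fix u
    have "\<exists>\<alpha>\<in>G. Max ((\<lambda>\<alpha>. ip (back_alpha M y u \<alpha>) \<sigma>) ` G) = ip (back_alpha M y u \<alpha>) \<sigma>" for y
      using Max_in[of "(\<lambda>\<alpha>. ip (back_alpha M y u \<alpha>) \<sigma>) ` G"] G by fastforce
    then obtain A where A: "\<And>y. A y \<in> G"
      "\<And>y. Max ((\<lambda>\<alpha>. ip (back_alpha M y u \<alpha>) \<sigma>) ` G) = ip (back_alpha M y u (A y)) \<sigma>"
      by metis
    define \<alpha> where "\<alpha> = (\<lambda>s. \<Sum>y\<in>UNIV. back_alpha M y u (A y) s)"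
    \<comment> \<open>\<beta> uses the same control \<open>u\<close> as \<alpha>; it lies in
      \<open>G'\<close> because \<open>G'\<close> contains, for each sample, one function for every
      control.\<close>
    define \<beta> where "\<beta> = (\<lambda>s. \<Sum>y\<in>UNIV. back_alpha M y u (sel y u \<sigma>') s)"
    have "ip \<alpha> \<sigma>' = (\<Sum>y\<in>UNIV. ip (back_alpha M y u (A y)) \<sigma>')"
      unfolding \<alpha>_def by (intro ip_back_sum S \<sigma>' G A)
    also have "\<dots> \<le> (\<Sum>y\<in>UNIV. ip (back_alpha M y u (sel y u \<sigma>')) \<sigma>')"
      using sel[OF \<sigma>'] A(1) by (intro sum_mono) (auto simp: is_arg_max_linorder)
    also have "\<dots> = ip \<beta> \<sigma>'"
      unfolding \<beta>_def by (intro ip_back_sum[symmetric] S \<sigma>' G selG)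
    finally have le: "ip \<alpha> \<sigma>' \<le> ip \<beta> \<sigma>'" .
    have "unit_fun \<alpha>" "unit_fun \<beta>"
      unfolding \<alpha>_def \<beta>_def by (intro unit_fun_back_sum G A selG \<sigma>')+
    from ip_difference_le[OF this \<sigma> S(2)[OF \<sigma>'] le] have "ip \<alpha> \<sigma> \<le> ip \<beta> \<sigma> + ?d"
      by simp
    moreover have "?m u = ip \<alpha> \<sigma>"
      unfolding \<alpha>_def A(2) by (intro ip_back_sum[symmetric] \<sigma> G A)
    moreover have "ip \<beta> \<sigma> \<le> V_pb G' \<sigma>"
      unfolding V_pb_def using fin \<sigma>' by (intro Max_ge) (auto simp: G' \<beta>_def)
    ultimately show "?m u \<le> V_pb G' \<sigma> + ?d"
      by simp
  qed simp
  ultimately have "\<bar>V_pb G' \<sigma> - H_op M (V_pb G) \<sigma>\<bar> \<le> ?d"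
    unfolding H by simp
  moreover have "norm1 (\<lambda>s. \<sigma>' s - \<sigma> s) = ennreal ?d"
    using \<sigma> S(2)[OF \<sigma>'] by (intro norm1_eq_ennreal) (simp add: nonneg_integrable_def)
  ultimately show ?thesis
    by (simp add: ennreal_leI)
qed

lemma H_op_nonexpansive:
  assumes "\<And>y u. ennreal \<bar>V (Phi M y u \<sigma>) - W (Phi M y u \<sigma>)\<bar> \<le> e"
  shows "ennreal \<bar>H_op M V \<sigma> - H_op M W \<sigma>\<bar> \<le> e"
proof (cases e)
  case (real r)
  \<comment> \<open>The one-sided estimate is proved for arbitrary \<open>V\<close> and
    \<open>W\<close>, so that it can be used in both directions.\<close>
  have le: "H_op M V \<sigma> \<le> H_op M W \<sigma> + r"
    if VW: "\<And>y u. \<bar>V (Phi M y u \<sigma>) - W (Phi M y u \<sigma>)\<bar> \<le> r" for V W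
    unfolding H_op_def
  proof (rule cSUP_least)
    fix u
    have "(\<Sum>y\<in>UNIV. V (Phi M y u \<sigma>)) \<le> (\<Sum>y\<in>UNIV. W (Phi M y u \<sigma>) + r)"
      using VW by (intro sum_mono) (simp add: abs_le_iff algebra_simps)
    \<comment> \<open>There are exactly \<open>n_obs M\<close> values of \<open>y\<close>, so
      dividing by \<open>n_obs M\<close> returns a single \<open>r\<close>.\<close>
    also have "\<dots> = (\<Sum>y\<in>UNIV. W (Phi M y u \<sigma>)) + n_obs M * r"
      by (simp add: sum.distrib n_obs_def)
    finally have "1 / n_obs M * (\<Sum>y\<in>UNIV. V (Phi M y u \<sigma>))
        \<le> 1 / n_obs M * (\<Sum>y\<in>UNIV. W (Phi M y u \<sigma>)) + r"
      using n_obs_pos by (simp add: field_simps)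
    also have "1 / n_obs M * (\<Sum>y\<in>UNIV. W (Phi M y u \<sigma>))
        \<le> (SUP u. 1 / n_obs M * (\<Sum>y\<in>UNIV. W (Phi M y u \<sigma>)))"
      by (intro cSUP_upper bdd_above_finite) auto
    finally show "1 / n_obs M * (\<Sum>y\<in>UNIV. V (Phi M y u \<sigma>))
        \<le> (SUP u. 1 / n_obs M * (\<Sum>y\<in>UNIV. W (Phi M y u \<sigma>))) + r"
      by simp
  qed simp
  have VW: "\<bar>V (Phi M y u \<sigma>) - W (Phi M y u \<sigma>)\<bar> \<le> r" for y u
    using assms[of y u] real by simp
  have "H_op M V \<sigma> \<le> H_op M W \<sigma> + r" "H_op M W \<sigma> \<le> H_op M V \<sigma> + r"
    by (intro le, metis VW abs_minus_commute)+
  then show ?thesis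
    using real by (simp add: abs_le_iff)
qed simp

end

section \<open>Accumulation of the losses over the horizon\<close>

theorem theorem1:
  fixes M :: "('n::finite, 'q::finite, 'u::finite, 'yx::finite, 'yq::finite) hybrid"
    and S :: "('n, 'q) sfun set" and \<Gamma> :: "nat \<Rightarrow> ('n, 'q) sfun set" and T t :: nat
  assumes "hybrid_system M"
    and "S \<subseteq> Sigma_stat M" and "finite S" and "S \<noteq> {}"
    and "pb_sets M S T \<Gamma>"
    and "t \<le> T"
  shows "sup_norm M (\<lambda>\<sigma>. V_pb (\<Gamma> (T - t)) \<sigma> - V_star M T (T - t) \<sigma>)
           \<le> of_nat t * sample_density M S"
proof -
  interpret hybrid_sys M
    by standard (rule assms(1))
  have Gamma_T: "\<Gamma> T = {ind_safe M}" and backup: "\<And>k. k < T \<Longrightarrow> pb_backup M S (\<Gamma> (Suc k)) (\<Gamma> k)"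
    using assms(5) by (auto simp: pb_sets_def)
  have S: "\<And>\<rho>. \<rho> \<in> S \<Longrightarrow> nonneg_integrable \<rho>"
    using assms(2) nonneg_integrable_Sigma_stat by blast
  \<comment> \<open>Finiteness and range are carried along because \<open>backup_error\<close> needs
    them for the set that is backed up.\<close>
  have "finite (\<Gamma> (T - t)) \<and> \<Gamma> (T - t) \<noteq> {} \<and> (\<forall>\<alpha>\<in>\<Gamma> (T - t). unit_fun \<alpha>) \<and>
      (\<forall>\<sigma>\<in>Sigma_stat M. ennreal \<bar>V_pb (\<Gamma> (T - t)) \<sigma> - V_star M T (T - t) \<sigma>\<bar>
         \<le> of_nat t * sample_density M S)"
    using assms(6)
  proof (induction t)
    case 0
    \<comment> \<open>At the horizon both values are the pairing with \<open>ind_safe M\<close>, so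
      the error is 0. The right-hand side is 0 even for infinite density, by the convention of
      \<open>ennreal\<close>.\<close>
    show ?case
      by (simp add: Gamma_T unit_fun_ind_safe V_star_horizon V_pb_def ip_commute)
  next
    case (Suc t)
    let ?k = "T - Suc t"
    have k: "?k < T" "Suc ?k = T - t"
      using Suc.prems by auto
    then have bk: "pb_backup M S (\<Gamma> (T - t)) (\<Gamma> ?k)"
      using backup[of ?k] by simp
    have fin: "finite (\<Gamma> (T - t))" "\<Gamma> (T - t) \<noteq> {}" "\<And>\<alpha>. \<alpha> \<in> \<Gamma> (T - t) \<Longrightarrow> unit_fun \<alpha>"
      and IH: "\<And>\<sigma>. \<sigma> \<in> Sigma_stat M \<Longrightarrow>
        ennreal \<bar>V_pb (\<Gamma> (T - t)) \<sigma> - V_star M T (T - t) \<sigma>\<bar> \<le> of_nat t * sample_density M S"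
      using Suc by auto
    have "unit_fun \<alpha>" if "\<alpha> \<in> \<Gamma> ?k" for \<alpha>
      using that bk fin(3) unfolding pb_backup_def is_arg_max_def
      by (auto intro!: unit_fun_back_sum)
    moreover have "ennreal \<bar>V_pb (\<Gamma> ?k) \<sigma> - V_star M T ?k \<sigma>\<bar> \<le> of_nat (Suc t) * sample_density M S"
      if \<sigma>: "\<sigma> \<in> Sigma_stat M" for \<sigma>
    proof -
      \<comment> \<open>The exact backup of the approximate value is the intermediate point: the
        first difference is the loss of this backup, the second is the earlier error passed through
        \<open>H_op\<close>.\<close>
      let ?H = "H_op M (V_pb (\<Gamma> (T - t))) \<sigma>"
      have "ennreal \<bar>V_pb (\<Gamma> ?k) \<sigma> - V_star M T ?k \<sigma>\<bar>
          \<le> ennreal (\<bar>V_pb (\<Gamma> ?k) \<sigma> - ?H\<bar> + \<bar>?H - V_star M T ?k \<sigma>\<bar>)"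
        by (intro ennreal_leI) linarith
      also have "\<dots> = ennreal \<bar>V_pb (\<Gamma> ?k) \<sigma> - ?H\<bar> + ennreal \<bar>?H - V_star M T ?k \<sigma>\<bar>"
        by simp
      also have "\<dots> \<le> sample_density M S + of_nat t * sample_density M S"
      proof (rule add_mono)
        \<comment> \<open>The loss is bounded by the distance to every sample, hence by the infimum
          over samples.\<close>
        have "ennreal \<bar>V_pb (\<Gamma> ?k) \<sigma> - ?H\<bar> \<le> (INF \<sigma>'\<in>S. norm1 (\<lambda>s. \<sigma>' s - \<sigma> s))"
          by (intro INF_greatest backup_error[OF fin assms(3) S bk]
              nonneg_integrable_Sigma_stat \<sigma>)
        also have "\<dots> \<le> sample_density M S"
          unfolding sample_density_def by (intro SUP_upper \<sigma>)
        finally show "ennreal \<bar>V_pb (\<Gamma> ?k) \<sigma> - ?H\<bar> \<le> sample_density M S" .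
        show "ennreal \<bar>?H - V_star M T ?k \<sigma>\<bar> \<le> of_nat t * sample_density M S"
          unfolding V_star_backward[OF k(1)] k(2)
          by (intro H_op_nonexpansive IH Sigma_stat.step \<sigma>)
      qed
      finally show ?thesis
        by (simp add: algebra_simps)
    qed
    ultimately show ?case
      using pb_backup_finite[OF bk assms(3,4)] by blast
  qed
  then show ?thesis
    unfolding sup_norm_def by (intro SUP_least) blast
qed

end
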